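(* Suppose the functions $p_v$ ($v\in V$) satisfy Assumption 1 (stated in the context). Then in the min-cost flow problem (FP) the cost function of every edge is convex: for each $v\in V$ the cost function $z\mapsto-\bar\xi_v^{-1}(z)\,z$ of edge $(v,t)$ is convex on $n_v\mathcal Z_v$, and the cost functions $z\mapsto-w_ez$ of the edges $e\in E$ and $z\mapsto0$ of the edges $(s,u)$ ($u\in U$) and $(s,t)$ are convex. Consequently (FP) is a convex min-cost flow problem.
   Context: $G=(U,V,E)$ is a finite bipartite graph with edges $e=(u,v)$, $u\in U$, $v\in V$; $\delta(a)$ is the set of edges incident to node $a$, assumed non-empty for every $a\in U\cup V$. Each edge $e$ has a weight $w_e\in\mathbb R$; each $u\in U$ has a capacity $c_u\in\mathbb Z_{>0}$. For each $v\in V$: $n_v$ is a positive integer, $\mathcal X_v\subseteq\mathbb R$ is a non-empty interval, $p_v:\mathcal X_v\to\mathcal Z_v\subseteq[0,1]$ is a function, and $\bar\xi_v(x):=n_vp_v(x)$, a map from $\mathcal X_v$ to $n_v\mathcal Z_v:=\{n_vz:z\in\mathcal Z_v\}$. It is assumed that for each $v\in V$ there is $x_v\in\mathcal X_v$ with $x_v>-\max_{e\in\delta(v)}w_e$. Assumption 1. For all $v\in V$: (a) $p_v$ is differentiable, strictly decreasing, and bijective from $\mathcal X_v$ onto $\mathcal Z_v$; (b) if $\mathcal X_v$ is bounded from above, then $\max\mathcal X_v$ exists and $p_v(\max\mathcal X_v)=0$; if $\mathcal X_v$ is unbounded from above, then $\lim_{x\to\infty}p_v(x)=0$; (c) $p_v'(x)/p_v(x)$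 is monotonically non-increasing on the interior of $\mathcal X_v$. Under Assumption 1, $\bar\xi_v$ is a bijection from $\mathcal X_v$ onto $n_v\mathcal Z_v$ with inverse $\bar\xi_v^{-1}$. Problem (FP): with $C:=\min\{\sum_{v\in V}\sup(n_v\mathcal Z_v),\ \sum_{u\in U}c_u\}$, minimize $$\sum_{v\in V}-\bar\xi_v^{-1}(z_{(v,t)})\,z_{(v,t)}-\sum_{e\in E}w_ez_e$$ over $\boldsymbol z\in\mathbb R^E$, $(z_{(s,u)})_{u\in U}\in\mathbb R^U$, $(z_{(v,t)})_{v\in V}\in\mathbb R^V$, $z_{(s,t)}\in\mathbb R$, subject to: $\sum_{u\in U}z_{(s,u)}+z_{(s,t)}=C$; $\sum_{v\in V}z_{(v,t)}+z_{(s,t)}=C$; $z_{(s,u)}-\sum_{e\in\delta(u)}z_e=0$ for all $u\in U$; $\sum_{e\in\delta(v)}z_e-z_{(v,t)}=0$ for all $v\in V$; $\sum_{e\in\delta(v)}z_e\in n_v\mathcal Z_v$ for all $v\in V$; $z_e\ge0$ for all $e\in E$; $0\le z_{(s,u)}\le c_u$ for all $u\in U$; $0\le z_{(s,t)}\le C$. It is viewed as a min-cost flow problem on the directed graph with nodes $U\cup V\cup\{s,t\}$ and edges $(s,u)$, $e=(u,v)\in E$, $(v,t)$, $(s,t)$, with supply $C$ at $s$, demand $C$ at $t$, and zero supply elsewhere. A min-cost flow problem minimizes a sum of edge costs, each a function of the flow on that edge, subject to flow conservation with given supplies/demands and to each edge flow lying in a given interval; it is called convex if every edge's cost function is convex on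 that edge's interval. *)

theory Defs
  imports "HOL-Analysis.Analysis" "Graph_Theory.Digraph"
begin

text \<open>
  General min-cost flow problems on finite digraphs (parallel arcs allowed). A demand is a negative
  supply. \<open>flow_range\<close> gives the interval in which the flow on an arc has to lie.
  Only the values of a flow on the arcs of the digraph matter.
\<close>

record ('n, 'a) flow_problem =
  network :: "('n, 'a) pre_digraph"
  node_supply :: "'n \<Rightarrow> real"
  flow_range :: "'a \<Rightarrow> real set"
  cost :: "'a \<Rightarrow> real \<Rightarrow> real"

definition min_cost_flow_problem :: "('n, 'a) flow_problem \<Rightarrow> bool" where
  "min_cost_flow_problem P \<longleftrightarrow>
     fin_digraph (network P) \<and> (\<forall>a \<in> arcs (network P). is_interval (flow_range P a))"

definition feasible_flow :: "('n, 'a) flow_problem \<Rightarrow> ('a \<Rightarrow> real) \<Rightarrow> bool" where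
  "feasible_flow P z \<longleftrightarrow>
     (\<forall>i \<in> verts (network P).
        (\<Sum>a \<in> out_arcs (network P) i. z a) - (\<Sum>a \<in> in_arcs (network P) i. z a) = node_supply P i) \<and>
     (\<forall>a \<in> arcs (network P). z a \<in> flow_range P a)"

definition flow_cost :: "('n, 'a) flow_problem \<Rightarrow> ('a \<Rightarrow> real) \<Rightarrow> real" where
  "flow_cost P z = (\<Sum>a \<in> arcs (network P). cost P a (z a))"

definition convex_min_cost_flow_problem :: "('n, 'a) flow_problem \<Rightarrow> bool" where
  "convex_min_cost_flow_problem P \<longleftrightarrow>
     min_cost_flow_problem P \<and> (\<forall>a \<in> arcs (network P). convex_on (flow_range P a) (cost P a))"


text \<open>
  Bipartite graphs are given by \<open>U\<close>, \<open>V\<close> and \<open>E \<subseteq> U \<times> V\<close>; since \<open>U\<close> and \<open>V\<close> live in different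
  types, they are disjoint by construction.
\<close>

definition deltaU :: "('u \<times> 'v) set \<Rightarrow> 'u \<Rightarrow> ('u \<times> 'v) set" where
  "deltaU E u = {e \<in> E. fst e = u}"

definition deltaV :: "('u \<times> 'v) set \<Rightarrow> 'v \<Rightarrow> ('u \<times> 'v) set" where
  "deltaV E v = {e \<in> E. snd e = v}"

text \<open>
  A function on \<open>X\<close> is a total function whose values outside \<open>X\<close> are irrelevant: at a boundary
  point belonging to \<open>X\<close>, differentiability is one-sided, and \<open>deriv\<close> is used in the interior only.
\<close>

definition assumption1 :: "real set \<Rightarrow> real set \<Rightarrow> (real \<Rightarrow> real) \<Rightarrow> bool" where
  "assumption1 X Z p \<longleftrightarrow>
     p differentiable_on X \<and> strict_antimono_on X p \<and> bij_betw p X Z \<and>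
     (bdd_above X \<longrightarrow> (\<exists>m \<in> X. (\<forall>x \<in> X. x \<le> m) \<and> p m = 0)) \<and>
     (\<not> bdd_above X \<longrightarrow> (p \<longlongrightarrow> 0) at_top) \<and>
     antimono_on (interior X) (\<lambda>x. deriv p x / p x)"

definition xi :: "('v \<Rightarrow> nat) \<Rightarrow> ('v \<Rightarrow> real \<Rightarrow> real) \<Rightarrow> 'v \<Rightarrow> real \<Rightarrow> real" where
  "xi n p v x = real (n v) * p v x"

definition xi_inv ::
    "('v \<Rightarrow> nat) \<Rightarrow> ('v \<Rightarrow> real set) \<Rightarrow> ('v \<Rightarrow> real \<Rightarrow> real) \<Rightarrow> 'v \<Rightarrow> real \<Rightarrow> real" where
  "xi_inv n X p v = inv_into (X v) (xi n p v)"

definition nZ :: "('v \<Rightarrow> nat) \<Rightarrow> ('v \<Rightarrow> real set) \<Rightarrow> 'v \<Rightarrow> real set" where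
  "nZ n Z v = (\<lambda>z. real (n v) * z) ` Z v"


datatype ('u, 'v) fp_node = Source | Sink | UNode 'u | VNode 'v

datatype ('u, 'v) fp_arc = SU 'u | UV "'u \<times> 'v" | VT 'v | ST

definition fp_C ::
    "'u set \<Rightarrow> 'v set \<Rightarrow> ('u \<Rightarrow> int) \<Rightarrow> ('v \<Rightarrow> nat) \<Rightarrow> ('v \<Rightarrow> real set) \<Rightarrow> real" where
  "fp_C U V c n Z = min (\<Sum>v\<in>V. Sup (nZ n Z v)) (\<Sum>u\<in>U. real_of_int (c u))"

definition fp_objective ::
    "'v set \<Rightarrow> ('u \<times> 'v) set \<Rightarrow> ('u \<times> 'v \<Rightarrow> real) \<Rightarrow> ('v \<Rightarrow> nat) \<Rightarrow> ('v \<Rightarrow> real set) \<Rightarrow>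
     ('v \<Rightarrow> real \<Rightarrow> real) \<Rightarrow> (('u, 'v) fp_arc \<Rightarrow> real) \<Rightarrow> real" where
  "fp_objective V E w n X p z =
     (\<Sum>v\<in>V. - xi_inv n X p v (z (VT v)) * z (VT v)) - (\<Sum>e\<in>E. w e * z (UV e))"

definition fp_feasible ::
    "'u set \<Rightarrow> 'v set \<Rightarrow> ('u \<times> 'v) set \<Rightarrow> ('u \<Rightarrow> int) \<Rightarrow> ('v \<Rightarrow> nat) \<Rightarrow> ('v \<Rightarrow> real set) \<Rightarrow>
     (('u, 'v) fp_arc \<Rightarrow> real) \<Rightarrow> bool" where
  "fp_feasible U V E c n Z z \<longleftrightarrow>
     (\<Sum>u\<in>U. z (SU u)) + z ST = fp_C U V c n Z \<and>
     (\<Sum>v\<in>V. z (VT v)) + z ST = fp_C U V c n Z \<and>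
     (\<forall>u\<in>U. z (SU u) - (\<Sum>e\<in>deltaU E u. z (UV e)) = 0) \<and>
     (\<forall>v\<in>V. (\<Sum>e\<in>deltaV E v. z (UV e)) - z (VT v) = 0) \<and>
     (\<forall>v\<in>V. (\<Sum>e\<in>deltaV E v. z (UV e)) \<in> nZ n Z v) \<and>
     (\<forall>e\<in>E. 0 \<le> z (UV e)) \<and>
     (\<forall>u\<in>U. 0 \<le> z (SU u) \<and> z (SU u) \<le> real_of_int (c u)) \<and>
     0 \<le> z ST \<and> z ST \<le> fp_C U V c n Z"

text \<open>
  The same program viewed as a min-cost flow problem. The interval of \<open>(v,t)\<close> is \<open>nZ n Z v\<close>, as
  the flow on this arc equals the flow into \<open>v\<close>, which the program restricts to this set.
\<close>

definition fp_digraph ::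
    "'u set \<Rightarrow> 'v set \<Rightarrow> ('u \<times> 'v) set \<Rightarrow> (('u, 'v) fp_node, ('u, 'v) fp_arc) pre_digraph" where
  "fp_digraph U V E =
     \<lparr> verts = {Source, Sink} \<union> UNode ` U \<union> VNode ` V,
       arcs = SU ` U \<union> UV ` E \<union> VT ` V \<union> {ST},
       tail = (\<lambda>a. case a of SU u \<Rightarrow> Source | UV e \<Rightarrow> UNode (fst e) | VT v \<Rightarrow> VNode v | ST \<Rightarrow> Source),
       head = (\<lambda>a. case a of SU u \<Rightarrow> UNode u | UV e \<Rightarrow> VNode (snd e) | VT v \<Rightarrow> Sink | ST \<Rightarrow> Sink) \<rparr>"

definition fp_flow_problem ::
    "'u set \<Rightarrow> 'v set \<Rightarrow> ('u \<times> 'v) set \<Rightarrow> ('u \<times> 'v \<Rightarrow> real) \<Rightarrow> ('u \<Rightarrow> int) \<Rightarrow> ('v \<Rightarrow> nat) \<Rightarrow>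
     ('v \<Rightarrow> real set) \<Rightarrow> ('v \<Rightarrow> real set) \<Rightarrow> ('v \<Rightarrow> real \<Rightarrow> real) \<Rightarrow>
     (('u, 'v) fp_node, ('u, 'v) fp_arc) flow_problem" where
  "fp_flow_problem U V E w c n X Z p =
     \<lparr> network = fp_digraph U V E,
       node_supply = (\<lambda>i. case i of Source \<Rightarrow> fp_C U V c n Z | Sink \<Rightarrow> - fp_C U V c n Z | _ \<Rightarrow> 0),
       flow_range = (\<lambda>a. case a of
           SU u \<Rightarrow> {0..real_of_int (c u)}
         | UV e \<Rightarrow> {0..}
         | VT v \<Rightarrow> nZ n Z v
         | ST \<Rightarrow> {0..fp_C U V c n Z}),
       cost = (\<lambda>a. case a of
           SU u \<Rightarrow> (\<lambda>z. 0)
         | UV e \<Rightarrow> (\<lambda>z. - w e * z)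
         | VT v \<Rightarrow> (\<lambda>z. - xi_inv n X p v z * z)
         | ST \<Rightarrow> (\<lambda>z. 0)) \<rparr>"

end

theory Submission
  imports Defs
begin

text \<open>
  Only the arcs \<open>(v,t)\<close> have a cost that is not affine. Let \<open>F = xi n p v\<close> and parametrise the
  cost \<open>f z = - z * F\<^sup>-\<^sup>1 z\<close> by the price \<open>x\<close>, that is \<open>z = F x\<close>. The derivative is
  \<open>f' (F x) = - x - F x / F' x\<close>. Part (c) of the assumption says that \<open>F' / F\<close>, which equals
  \<open>p' / p\<close>, is nonincreasing in \<open>x\<close>; being negative, its reciprocal is nondecreasing, so
  \<open>f' (F x)\<close> is nonincreasing in \<open>x\<close>. As \<open>F\<close> reverses the order, \<open>f'\<close> is nondecreasing in \<open>z\<close>, and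
  \<open>f\<close> is convex.

  Two points need care. The formula for \<open>f'\<close> requires \<open>F' < 0\<close>, which strict monotonicity alone
  does not give; it follows from (c) by \<open>deriv_neg_of_antimono_log_deriv\<close>. Moreover the formula
  holds in the interior of the range of \<open>F\<close> only, whereas convexity is claimed on the whole range,
  in which a boundary flow such as \<open>0\<close> may occur; \<open>convex_on_if_deriv_mono_interior\<close> covers the
  boundary by continuity.
\<close>

section \<open>Convexity of the inverse demand cost\<close>

text \<open>
  The mean value theorem requires the derivative only strictly between the points at which the
  function is evaluated, hence only in the interior. For \<open>x < m < y\<close> it makes the chord slopes over
  \<open>{x..m}\<close> and \<open>{m..y}\<close> values of the derivative at ordered points.
\<close>

lemma convex_on_if_deriv_mono_interior:
  fixes f f' :: "real \<Rightarrow> real"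
  assumes S: "is_interval S" and cont: "continuous_on S f"
    and deriv: "\<And>z. z \<in> interior S \<Longrightarrow> (f has_real_derivative f' z) (at z)"
    and mono: "mono_on (interior S) f'"
  shows "convex_on S f"
proof (rule convex_on_linorderI)
  show "convex S"
    using S by (simp add: is_interval_convex_1)
next
  fix t x y :: real
  assume t: "0 < t" "t < 1" and xy: "x \<in> S" "y \<in> S" "x < y"
  define m where "m = (1 - t) * x + t * y"
  have mx: "m - x = t * (y - x)" and ym: "y - m = (1 - t) * (y - x)"
    by (simp_all add: m_def algebra_simps)
  have "x < m" "m < y"
    using mx ym t xy by (smt (verit) mult_pos_pos)+
  have sub: "{x..y} \<subseteq> S"
    using S xy unfolding is_interval_1 by (meson atLeastAtMost_iff subsetI)
  have inner: "z \<in> interior S" if "x < z" "z < y" for z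
    using that sub interior_mono[OF sub] by (auto simp: interior_atLeastAtMost_real)
  have slope: "\<exists>z. a < z \<and> z < b \<and> f b - f a = (b - a) * f' z"
    if "x \<le> a" "a < b" "b \<le> y" for a b
  proof -
    have "\<exists>l z. a < z \<and> z < b \<and> DERIV f z :> l \<and> f b - f a = (b - a) * l"
    proof (rule MVT[OF \<open>a < b\<close>])
      show "continuous_on {a..b} f"
        using sub that by (intro continuous_on_subset[OF cont]) auto
      show "f differentiable (at z)" if "a < z" "z < b" for z
        using deriv[OF inner[of z]] that \<open>x \<le> a\<close> \<open>b \<le> y\<close> real_differentiable_def by fastforce
    qed
    then show ?thesis
      using deriv inner that by (smt (verit) DERIV_unique)
  qed
  obtain z1 where z1: "x < z1" "z1 < m" "f m - f x = (m - x) * f' z1"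
    using slope[of x m] \<open>x < m\<close> \<open>m < y\<close> by auto
  obtain z2 where z2: "m < z2" "z2 < y" "f y - f m = (y - m) * f' z2"
    using slope[of m y] \<open>x < m\<close> \<open>m < y\<close> by auto
  have "f' z1 \<le> f' z2"
    using mono inner z1 z2 \<open>x < m\<close> \<open>m < y\<close> by (intro mono_onD[OF mono]) auto
  then have "(1 - t) * t * (y - x) * f' z1 \<le> (1 - t) * t * (y - x) * f' z2"
    using t xy by (intro mult_left_mono) auto
  then have "(1 - t) * (f m - f x) \<le> t * (f y - f m)"
    by (simp add: z1(3) z2(3) mx ym mult_ac)
  then have "f m \<le> (1 - t) * f x + t * f y"
    by (simp add: algebra_simps)
  then show "f ((1 - t) *\<^sub>R x + t *\<^sub>R y) \<le> (1 - t) * f x + t * f y"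
    by (simp add: m_def)
qed

text \<open>
  At an interior point a strictly decreasing nonnegative function still has to fall below its
  value, so that value is positive.
\<close>

lemma pos_interior_of_strict_antimono:
  fixes F :: "real \<Rightarrow> real"
  assumes "strict_antimono_on X F" and "\<And>x. x \<in> X \<Longrightarrow> 0 \<le> F x" and "x \<in> interior X"
  shows "0 < F x"
proof -
  obtain e where e: "e > 0" "cball x e \<subseteq> X"
    using assms(3) by (auto simp: mem_interior_cball)
  have "x \<in> X" "x + e \<in> X"
    using e by (auto simp: subset_iff dist_real_def)
  then show ?thesis
    using assms(2)[of "x + e"] monotone_onD[OF assms(1), of x "x + e"] e by auto
qed

text \<open>
  If the derivative of \<open>F\<close> vanished at \<open>x\<close>, monotonicity of the logarithmic derivative would make
  it nonnegative to the left of \<open>x\<close>, where \<open>F\<close> strictly decreases.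
\<close>

lemma deriv_neg_of_antimono_log_deriv:
  fixes F :: "real \<Rightarrow> real"
  assumes diff: "F differentiable_on X" and dec: "strict_antimono_on X F"
    and nonneg: "\<And>x. x \<in> X \<Longrightarrow> 0 \<le> F x"
    and log: "antimono_on (interior X) (\<lambda>x. deriv F x / F x)"
    and x: "x \<in> interior X"
  shows "(F has_real_derivative deriv F x) (at x)" and "deriv F x < 0"
proof -
  have der: "(F has_real_derivative deriv F y) (at y)" if "y \<in> interior X" for y
  proof -
    have "F differentiable (at y)"
      using that differentiable_on_subset[OF diff interior_subset]
      by (simp add: differentiable_on_eq_differentiable_at)
    then show ?thesis
      by (simp add: DERIV_deriv_iff_real_differentiable)
  qed
  then show "(F has_real_derivative deriv F x) (at x)"
    using x .
  show "deriv F x < 0"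
  proof (rule ccontr)
    assume "\<not> deriv F x < 0"
    then have x_nonneg: "0 \<le> deriv F x / F x"
      using pos_interior_of_strict_antimono[OF dec nonneg x] by simp
    obtain e where e: "e > 0" "cball x e \<subseteq> interior X"
      using x by (metis interior_interior mem_interior_cball)
    have int: "y \<in> interior X" if "x - e \<le> y" "y \<le> x" for y
      using e that by (auto simp: subset_iff dist_real_def)
    have "F (x - e) \<le> F x"
    proof (rule DERIV_nonneg_imp_nondecreasing[where f = F])
      fix y assume y: "x - e \<le> y" "y \<le> x"
      have "0 \<le> deriv F y / F y"
        using x_nonneg monotone_onD[OF log int[OF y] x] y by auto
      then have "0 \<le> deriv F y"
        using pos_interior_of_strict_antimono[OF dec nonneg int[OF y]]
        by (simp add: zero_le_divide_iff)
      then show "\<exists>D. DERIV F y :> D \<and> D \<ge> 0"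
        using der[OF int[OF y]] by blast
    qed (use e in auto)
    moreover have "F x < F (x - e)"
      using e x int[of "x - e"] interior_subset[of X] by (intro monotone_onD[OF dec]) auto
    ultimately show False
      by simp
  qed
qed

text \<open>
  The analytic core, for an arbitrary demand function \<open>F\<close> of the price. The inverse function rule
  gives the derivative at a flow \<open>z\<close> in terms of the price \<open>g z\<close>; since \<open>g\<close> is decreasing,
  the derivatives at two flows are compared through their prices.
\<close>

lemma convex_on_neg_inverse_demand_revenue:
  fixes F :: "real \<Rightarrow> real"
  assumes X: "is_interval X" and diff: "F differentiable_on X" and dec: "strict_antimono_on X F"
    and nonneg: "\<And>x. x \<in> X \<Longrightarrow> 0 \<le> F x"
    and log: "antimono_on (interior X) (\<lambda>x. deriv F x / F x)"
  shows "convex_on (F ` X) (\<lambda>z. - inv_into X F z * z)"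
proof -
  define S where "S = F ` X"
  define g where "g = inv_into X F"
  have cont_F: "continuous_on X F"
    using diff by (rule differentiable_imp_continuous_on)
  have inj: "inj_on F X"
    using dec by (simp add: strict_antimono_iff_antimono)
  have F_g: "F (g z) = z" and g_X: "g z \<in> X" if "z \<in> S" for z
    using that by (simp_all add: S_def g_def f_inv_into_f inv_into_into)
  have S: "is_interval S"
    using X cont_F unfolding S_def is_interval_connected_1 by (rule connected_continuous_image[rotated])
  have cont_g: "continuous_on S g"
  proof -
    have "path_connected X"
      using X by (simp add: is_interval_path_connected)
    then obtain h where h: "homeomorphism X S F h"
      using homeomorphism_into_1d[OF _ cont_F S_def[symmetric] inj] by blast
    then have "h z = g z" if "z \<in> S" for z
      using that inj unfolding homeomorphism_def g_def S_def
      by (metis imageE inv_into_f_f)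
    then show ?thesis
      using h continuous_on_cong unfolding homeomorphism_def by force
  qed
  have g_less: "g b < g a" if "a \<in> S" "b \<in> S" "a < b" for a b
    using that monotone_onD[OF dec g_X g_X, of a b] F_g by (metis not_less_iff_gr_or_eq)
  have g_interior: "g z \<in> interior X" if z: "z \<in> interior S" for z
  proof -
    obtain e where e: "e > 0" "cball z e \<subseteq> S"
      using z by (auto simp: mem_interior_cball)
    have zS: "z \<in> S" "z - e \<in> S" "z + e \<in> S"
      using e by (auto simp: subset_iff dist_real_def)
    have "{g (z + e)..g (z - e)} \<subseteq> X"
      using X g_X zS by (meson atLeastAtMost_iff is_interval_1 subsetI)
    moreover have "g (z + e) < g z" "g z < g (z - e)"
      using g_less zS e by auto
    ultimately show ?thesis
      using interior_mono[of "{g (z + e)..g (z - e)}" X] by (auto simp: interior_atLeastAtMost_real)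
  qed
  define f' where "f' z = - (g z + F (g z) / deriv F (g z))" for z
  have "convex_on S (\<lambda>z. - g z * z)"
  proof (rule convex_on_if_deriv_mono_interior[OF S])
    show "continuous_on S (\<lambda>z. - g z * z)"
      by (intro continuous_intros cont_g)
  next
    fix z assume z: "z \<in> interior S"
    note F' = deriv_neg_of_antimono_log_deriv[OF diff dec nonneg log g_interior[OF z]]
    obtain e where e: "e > 0" "cball z e \<subseteq> S"
      using z by (auto simp: mem_interior_cball)
    have "DERIV g z :> inverse (deriv F (g z))"
    proof (rule DERIV_inverse_function[where f = F and a = "z - e" and b = "z + e"])
      show "isCont g z"
        using cont_g z by (rule continuous_on_interior)
      show "F (g y) = y" if "z - e < y" "y < z + e" for y
        using that e by (intro F_g) (auto simp: subset_iff dist_real_def)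
    qed (use F' e in auto)
    then have "((\<lambda>z. - g z * z) has_real_derivative - g z - z * inverse (deriv F (g z))) (at z)"
      by (auto intro!: derivative_eq_intros simp: algebra_simps)
    moreover have "F (g z) = z"
      using z interior_subset F_g by blast
    ultimately show "((\<lambda>z. - g z * z) has_real_derivative f' z) (at z)"
      by (simp add: f'_def divide_inverse mult.commute)
  next
    show "mono_on (interior S) f'"
    proof (rule mono_onI)
      fix a b assume ab: "a \<in> interior S" "b \<in> interior S" "a \<le> b"
      have g_le: "g b \<le> g a"
        using ab g_less[of a b] interior_subset[of S] by (cases "a = b") (auto simp: subset_iff)
      note int = g_interior[OF ab(1)] g_interior[OF ab(2)]
      have "deriv F (g a) / F (g a) \<le> deriv F (g b) / F (g b)"
        using monotone_onD[OF log int(2,1) g_le] .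
      moreover have "deriv F (g b) / F (g b) < 0"
        using deriv_neg_of_antimono_log_deriv(2)[OF diff dec nonneg log int(2)]
          pos_interior_of_strict_antimono[OF dec nonneg int(2)] by (simp add: divide_neg_pos)
      ultimately have "inverse (deriv F (g b) / F (g b)) \<le> inverse (deriv F (g a) / F (g a))"
        by (intro le_imp_inverse_le_neg)
      then show "f' a \<le> f' b"
        using g_le by (simp add: f'_def)
    qed
  qed
  then show ?thesis
    by (simp add: S_def g_def)
qed

text \<open>
  Scaling by \<open>n v\<close> leaves the logarithmic derivative of the purchase probability unchanged.
\<close>

lemma convex_on_sink_arc_cost:
  assumes n: "0 < n v" and X: "is_interval (X v)" and Z: "Z v \<subseteq> {0..1}"
    and p: "assumption1 (X v) (Z v) (p v)"
  shows "is_interval (nZ n Z v)" and "convex_on (nZ n Z v) (\<lambda>z. - xi_inv n X p v z * z)"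
proof -
  note p = p[unfolded assumption1_def]
  have Z_eq: "Z v = p v ` X v"
    using p by (simp add: bij_betw_def)
  have range: "nZ n Z v = xi n p v ` X v"
    by (auto simp: nZ_def xi_def Z_eq)
  have diff: "xi n p v differentiable_on X v"
    using p unfolding xi_def[abs_def] by (intro derivative_intros) auto
  have dec: "strict_antimono_on (X v) (xi n p v)"
    using p n by (auto simp: monotone_on_def xi_def)
  have nonneg: "0 \<le> xi n p v x" if "x \<in> X v" for x
    using that Z Z_eq by (auto simp: xi_def)
  have same_log_deriv: "deriv (xi n p v) x / xi n p v x = deriv (p v) x / p v x"
    if "x \<in> interior (X v)" for x
  proof -
    have "p v differentiable (at x)"
      using that p differentiable_on_subset[OF _ interior_subset]
      by (metis differentiable_on_eq_differentiable_at open_interior)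
    then have "(p v has_real_derivative deriv (p v) x) (at x)"
      by (simp add: DERIV_deriv_iff_real_differentiable)
    then have "(xi n p v has_real_derivative real (n v) * deriv (p v) x) (at x)"
      unfolding xi_def[abs_def] by (rule DERIV_cmult)
    then show ?thesis
      using n by (simp add: DERIV_imp_deriv xi_def)
  qed
  have log: "antimono_on (interior (X v)) (\<lambda>x. deriv (xi n p v) x / xi n p v x)"
    using p same_log_deriv by (simp add: monotone_on_def)
  show "convex_on (nZ n Z v) (\<lambda>z. - xi_inv n X p v z * z)"
    using convex_on_neg_inverse_demand_revenue[OF X diff dec nonneg log]
    by (simp add: range xi_inv_def)
  then show "is_interval (nZ n Z v)"
    by (simp add: is_interval_convex_1 convex_on_imp_convex)
qed

section \<open>The program as a min-cost flow problem\<close>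

lemma fin_digraph_fp_digraph:
  assumes "finite U" "finite V" "E \<subseteq> U \<times> V"
  shows "fin_digraph (fp_digraph U V E)"
proof
  have "finite E"
    using assms finite_subset by blast
  then show "finite (arcs (fp_digraph U V E))" "finite (verts (fp_digraph U V E))"
    using assms by (auto simp: fp_digraph_def)
qed (use assms in \<open>auto simp: fp_digraph_def\<close>)

lemma out_arcs_fp_digraph:
  assumes "E \<subseteq> U \<times> V"
  shows "out_arcs (fp_digraph U V E) Source = SU ` U \<union> {ST}"
    and "out_arcs (fp_digraph U V E) Sink = {}"
    and "u \<in> U \<Longrightarrow> out_arcs (fp_digraph U V E) (UNode u) = UV ` deltaU E u"
    and "v \<in> V \<Longrightarrow> out_arcs (fp_digraph U V E) (VNode v) = {VT v}"
  using assms by (auto simp: out_arcs_def fp_digraph_def deltaU_def)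

lemma in_arcs_fp_digraph:
  assumes "E \<subseteq> U \<times> V"
  shows "in_arcs (fp_digraph U V E) Source = {}"
    and "in_arcs (fp_digraph U V E) Sink = VT ` V \<union> {ST}"
    and "u \<in> U \<Longrightarrow> in_arcs (fp_digraph U V E) (UNode u) = {SU u}"
    and "v \<in> V \<Longrightarrow> in_arcs (fp_digraph U V E) (VNode v) = UV ` deltaV E v"
  using assms by (auto simp: in_arcs_def fp_digraph_def deltaV_def)

lemma sum_SU_ST:
  assumes "finite U"
  shows "sum z (SU ` U \<union> {ST}) = (\<Sum>u\<in>U. z (SU u)) + z ST"
  using assms by (subst sum.union_disjoint) (auto simp: sum.reindex inj_on_def)

lemma sum_VT_ST:
  assumes "finite V"
  shows "sum z (VT ` V \<union> {ST}) = (\<Sum>v\<in>V. z (VT v)) + z ST"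
  using assms by (subst sum.union_disjoint) (auto simp: sum.reindex inj_on_def)

lemma sum_UV: "sum z (UV ` A) = (\<Sum>e\<in>A. z (UV e))"
  by (simp add: sum.reindex inj_on_def)

text \<open>
  The program bounds the flow into \<open>v\<close>, the flow problem that on the arc \<open>(v,t)\<close>; conservation at
  \<open>v\<close> equates them.
\<close>

lemma fp_feasible_iff_feasible_flow:
  assumes "finite U" "finite V" "E \<subseteq> U \<times> V"
  shows "fp_feasible U V E c n Z z \<longleftrightarrow> feasible_flow (fp_flow_problem U V E w c n X Z p) z"
proof -
  let ?G = "fp_digraph U V E" and ?P = "fp_flow_problem U V E w c n X Z p"
  let ?C = "fp_C U V c n Z"
  note arcs = out_arcs_fp_digraph[OF assms(3)] in_arcs_fp_digraph[OF assms(3)]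
  have net: "network ?P = ?G"
    by (simp add: fp_flow_problem_def)
  have conservation: "(\<forall>i \<in> verts ?G. sum z (out_arcs ?G i) - sum z (in_arcs ?G i) = node_supply ?P i) \<longleftrightarrow>
      (\<Sum>u\<in>U. z (SU u)) + z ST = ?C \<and> (\<Sum>v\<in>V. z (VT v)) + z ST = ?C \<and>
      (\<forall>u\<in>U. z (SU u) - (\<Sum>e\<in>deltaU E u. z (UV e)) = 0) \<and>
      (\<forall>v\<in>V. (\<Sum>e\<in>deltaV E v. z (UV e)) - z (VT v) = 0)"
  proof -
    have verts: "verts ?G = {Source, Sink} \<union> UNode ` U \<union> VNode ` V"
      by (simp add: fp_digraph_def)
    have "(\<forall>i \<in> verts ?G. sum z (out_arcs ?G i) - sum z (in_arcs ?G i) = node_supply ?P i) \<longleftrightarrow>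
      (\<Sum>u\<in>U. z (SU u)) + z ST = ?C \<and> - ((\<Sum>v\<in>V. z (VT v)) + z ST) = - ?C \<and>
      (\<forall>u\<in>U. (\<Sum>e\<in>deltaU E u. z (UV e)) - z (SU u) = 0) \<and>
      (\<forall>v\<in>V. z (VT v) - (\<Sum>e\<in>deltaV E v. z (UV e)) = 0)"
      unfolding verts ball_Un ball_simps
      by (simp add: arcs sum_SU_ST[OF assms(1)] sum_VT_ST[OF assms(2)] sum_UV fp_flow_problem_def
          del: Un_insert_right)
    then show ?thesis
      by auto
  qed
  have ranges: "(\<forall>a \<in> arcs ?G. z a \<in> flow_range ?P a) \<longleftrightarrow>
      (\<forall>v\<in>V. z (VT v) \<in> nZ n Z v) \<and> (\<forall>e\<in>E. 0 \<le> z (UV e)) \<and>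
      (\<forall>u\<in>U. 0 \<le> z (SU u) \<and> z (SU u) \<le> real_of_int (c u)) \<and> 0 \<le> z ST \<and> z ST \<le> ?C"
    by (auto simp: fp_digraph_def fp_flow_problem_def ball_Un)
  show ?thesis
    unfolding fp_feasible_def feasible_flow_def net conservation ranges by auto
qed

lemma fp_objective_eq_flow_cost:
  assumes "finite U" "finite V" "E \<subseteq> U \<times> V"
  shows "fp_objective V E w n X p z = flow_cost (fp_flow_problem U V E w c n X Z p) z"
proof -
  let ?P = "fp_flow_problem U V E w c n X Z p"
  let ?h = "\<lambda>a. cost ?P a (z a)"
  have "finite E"
    using assms finite_subset by blast
  have "arcs (network ?P) = (SU ` U \<union> {ST}) \<union> (UV ` E \<union> VT ` V)"
    by (auto simp: fp_flow_problem_def fp_digraph_def)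
  then have "flow_cost ?P z = sum ?h ((SU ` U \<union> {ST}) \<union> (UV ` E \<union> VT ` V))"
    by (simp add: flow_cost_def)
  also have "\<dots> = sum ?h (SU ` U \<union> {ST}) + sum ?h (UV ` E \<union> VT ` V)"
    using assms \<open>finite E\<close> by (intro sum.union_disjoint) auto
  also have "sum ?h (UV ` E \<union> VT ` V) = sum ?h (UV ` E) + sum ?h (VT ` V)"
    using assms \<open>finite E\<close> by (intro sum.union_disjoint) auto
  also have "sum ?h (SU ` U \<union> {ST}) = 0"
    by (intro sum.neutral) (auto simp: fp_flow_problem_def)
  also have "sum ?h (UV ` E) = - (\<Sum>e\<in>E. w e * z (UV e))"
    by (simp add: sum.reindex inj_on_def fp_flow_problem_def sum_negf)
  also have "sum ?h (VT ` V) = (\<Sum>v\<in>V. - xi_inv n X p v (z (VT v)) * z (VT v))"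
    by (simp add: sum.reindex inj_on_def fp_flow_problem_def)
  finally show ?thesis
    by (simp add: fp_objective_def)
qed

lemma convex_on_scaling:
  fixes k :: real
  assumes "convex S"
  shows "convex_on S (\<lambda>z. k * z)"
  using assms by (simp add: convex_on_def algebra_simps)

section \<open>Convexity of the flow problem\<close>

theorem theorem5:
  fixes U :: "'u set" and V :: "'v set" and E :: "('u \<times> 'v) set"
    and w :: "'u \<times> 'v \<Rightarrow> real" and c :: "'u \<Rightarrow> int" and n :: "'v \<Rightarrow> nat"
    and X Z :: "'v \<Rightarrow> real set" and p :: "'v \<Rightarrow> real \<Rightarrow> real"
  assumes "finite U" and "finite V" and "E \<subseteq> U \<times> V"
    and "\<forall>u\<in>U. deltaU E u \<noteq> {}" and "\<forall>v\<in>V. deltaV E v \<noteq> {}"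
    and "\<forall>u\<in>U. 0 < c u"
    and "\<forall>v\<in>V. 0 < n v"
    and "\<forall>v\<in>V. X v \<noteq> {} \<and> is_interval (X v)"
    and "\<forall>v\<in>V. Z v \<subseteq> {0..1} \<and> p v ` X v \<subseteq> Z v"
    and "\<forall>v\<in>V. \<exists>x\<in>X v. x > - Max (w ` deltaV E v)"
    and "\<forall>v\<in>V. assumption1 (X v) (Z v) (p v)"
  shows "(\<forall>v\<in>V. convex_on (nZ n Z v) (\<lambda>z. - xi_inv n X p v z * z)) \<and>
    (\<forall>e\<in>E. convex_on UNIV (\<lambda>z::real. - w e * z)) \<and>
    (\<forall>u\<in>U. convex_on {0..real_of_int (c u)} (\<lambda>z. 0)) \<and>
    convex_on {0..fp_C U V c n Z} (\<lambda>z. 0) \<and>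
    convex_min_cost_flow_problem (fp_flow_problem U V E w c n X Z p) \<and>
    (\<forall>z. fp_feasible U V E c n Z z \<longleftrightarrow> feasible_flow (fp_flow_problem U V E w c n X Z p) z) \<and>
    (\<forall>z. fp_objective V E w n X p z = flow_cost (fp_flow_problem U V E w c n X Z p) z)"
proof -
  have sink: "is_interval (nZ n Z v)" "convex_on (nZ n Z v) (\<lambda>z. - xi_inv n X p v z * z)"
    if "v \<in> V" for v
    using that assms(7-9,11) convex_on_sink_arc_cost[of n v X Z p] by auto
  let ?P = "fp_flow_problem U V E w c n X Z p"
  have "is_interval (flow_range ?P a) \<and> convex_on (flow_range ?P a) (cost ?P a)"
    if "a \<in> arcs (network ?P)" for a
  proof (cases a)
    case (UV e)
    then show ?thesis
      by (simp add: fp_flow_problem_def is_interval_ci convex_on_scaling)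
  next
    case (VT v)
    then have "v \<in> V"
      using that by (auto simp: fp_flow_problem_def fp_digraph_def)
    then show ?thesis
      using sink VT by (simp add: fp_flow_problem_def)
  qed (auto simp: fp_flow_problem_def is_interval_cc convex_on_const)
  moreover have "fin_digraph (network ?P)"
    using fin_digraph_fp_digraph[OF assms(1-3)] by (simp add: fp_flow_problem_def)
  ultimately have "convex_min_cost_flow_problem ?P"
    by (simp add: convex_min_cost_flow_problem_def min_cost_flow_problem_def)
  moreover have "convex_on UNIV (\<lambda>z::real. - w e * z)" for e
    by (rule convex_on_scaling) simp
  ultimately show ?thesis
    using sink(2) fp_feasible_iff_feasible_flow[OF assms(1-3)]
      fp_objective_eq_flow_cost[OF assms(1-3)]
    by (intro conjI ballI allI) (auto simp: convex_on_const)
qed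

end
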